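(* Let $B:\mathbb R^2\to\mathbb R^2$ be the rotation by $\pi/2$ about the origin, i.e. the linear operator with matrix $\begin{pmatrix}0&-1\\1&0\end{pmatrix}$. Let $\gamma>0$, $\lambda>0$, and let $B_\lambda$ be the Yosida approximation of $B$ of parameter $\lambda$, which is the $\lambda$-cocoercive linear operator $$B_\lambda=\frac1{1+\lambda^2}\begin{pmatrix}\lambda&-1\\1&\lambda\end{pmatrix}.$$ Consider the dynamical system $$(\ast)\qquad \ddot X(t)+\gamma\dot X(t)+B_\lambda X(t)=0 .$$ Put $$a_2=\frac12\left(-\gamma+\frac1{\sqrt2}\left(\Big(\gamma^2-\frac{4\lambda}{1+\lambda^2}\Big)+\sqrt{\Big(\gamma^2-\frac{4\lambda}{1+\lambda^2}\Big)^2+\frac{16}{(1+\lambda^2)^2}}\right)^{1/2}\right).$$ Then $(\ast)$ has non-convergent solutions (as $t\to+\infty$) if $a_2\ge 0$, or equivalently if $$\sqrt{\gamma^4-\frac{8\gamma^2\lambda}{1+\lambda^2}+\frac{16}{1+\lambda^2}}\ \ge\ \gamma^2+\frac{4\lambda}{1+\lambda^2}.$$ Setting $\lambda=\theta/\gamma^2$ (with $\theta\ge 0$), this last inequality is equivalent to $$\gamma^4(1-\theta)\ge\theta^3 .$$ Hence $(\ast)$ has non-convergent solution trajectories when $\theta\in[0,1)$, which means that the condition $\lambda\gamma^2<1$ does not ensure convergence of the trajectories of the dynamical system $\ddot u(t)+\gamma\dot u(t)+\nabla\phi(u(t))+A(u(t))=0$, where $\phi$ is convex and differentiable and $A$ is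 maximal monotone and $\lambda$-cocoercive.
   Context: The Yosida approximation of parameter $\lambda>0$ of a maximal monotone operator $B$ on a Hilbert space is $B_\lambda=\frac1\lambda\big(I-(I+\lambda B)^{-1}\big)$. An operator $A:\mathcal H\to\mathcal H$ on a real Hilbert space $\mathcal H$ is $\lambda$-cocoercive if $\langle Av-Aw,v-w\rangle\ge\lambda|Av-Aw|^2$ for all $v,w\in\mathcal H$. In the general system, $\phi:\mathcal H\to\mathbb R$ is a convex differentiable function whose gradient $\nabla\phi$ is Lipschitz continuous on bounded sets, and $\gamma>0$ is a damping parameter; the system $(\ast)$ is the special case $\mathcal H=\mathbb R^2$, $\phi=0$, $A=B_\lambda$. The number $a_2$ is the larger of the real parts of the two complex roots $r$ of $r^2+\gamma r+\frac{\lambda-i}{1+\lambda^2}=0$, which arises by seeking solutions $X(t)=e^{rt}(1,i)^T$ of $(\ast)$.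
   Formalization: "Non-convergent when θ∈[0,1)" fails for some γ (θ=1/2, γ=1/10: all solutions tend to 0); it is proved for all γ>0 with γ⁴(1−θ)≥θ³, hence for all large γ given θ. At θ=0, where the Yosida approximation is undefined, the displayed matrix is used. *)

theory Defs
  imports "HOL-Analysis.Analysis"
begin

section \<open>Monotone operators on a real Hilbert space\<close>

text \<open>Set-valued operators are functions \<open>'a \<Rightarrow> 'a set\<close>; a single-valued operator \<open>A\<close>
  is regarded as the set-valued operator \<open>\<lambda>x. {A x}\<close>.\<close>

definition monotone_operator :: "('a::{real_inner,complete_space} \<Rightarrow> 'a set) \<Rightarrow> bool" where
  "monotone_operator M \<longleftrightarrow>
     (\<forall>x y. \<forall>u \<in> M x. \<forall>v \<in> M y. (u - v) \<bullet> (x - y) \<ge> 0)"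

definition maximal_monotone :: "('a::{real_inner,complete_space} \<Rightarrow> 'a set) \<Rightarrow> bool" where
  "maximal_monotone M \<longleftrightarrow>
     monotone_operator M \<and>
     (\<forall>N. monotone_operator N \<and> (\<forall>x. M x \<subseteq> N x) \<longrightarrow> N = M)"

text \<open>The resolvent \<open>(I + \<lambda> M)\<^sup>-\<^sup>1\<close>; by Minty's theorem it is everywhere defined and
  single-valued when \<open>M\<close> is maximal monotone and \<open>\<lambda> > 0\<close>.\<close>

definition resolvent :: "real \<Rightarrow> ('a::{real_inner,complete_space} \<Rightarrow> 'a set) \<Rightarrow> 'a \<Rightarrow> 'a" where
  "resolvent l M x = (THE y. \<exists>v \<in> M y. x = y + l *\<^sub>R v)"

definition yosida :: "real \<Rightarrow> ('a::{real_inner,complete_space} \<Rightarrow> 'a set) \<Rightarrow> 'a \<Rightarrow> 'a" where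
  "yosida l M x = (1 / l) *\<^sub>R (x - resolvent l M x)"

definition cocoercive :: "real \<Rightarrow> ('a::{real_inner,complete_space} \<Rightarrow> 'a) \<Rightarrow> bool" where
  "cocoercive l A \<longleftrightarrow> (\<forall>v w. (A v - A w) \<bullet> (v - w) \<ge> l * (norm (A v - A w))\<^sup>2)"

section \<open>Damped second-order systems\<close>

definition gradient :: "('a::{real_inner,complete_space} \<Rightarrow> real) \<Rightarrow> 'a \<Rightarrow> 'a" where
  "gradient \<phi> x = (THE D. GDERIV \<phi> x :> D)"

definition lipschitz_on_bounded_sets ::
    "('a::{real_inner,complete_space} \<Rightarrow> 'a) \<Rightarrow> bool" where
  "lipschitz_on_bounded_sets G \<longleftrightarrow> (\<forall>S. bounded S \<longrightarrow> (\<exists>L. L-lipschitz_on S G))"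

text \<open>Classical solutions on \<open>[0, \<infinity>)\<close> of \<open>u'' + \<gamma> u' + F(u) = 0\<close>; \<open>V\<close> is the velocity \<open>u'\<close>,
  and derivatives at \<open>0\<close> are one-sided.\<close>

definition damped_solution ::
    "real \<Rightarrow> ('a::{real_inner,complete_space} \<Rightarrow> 'a) \<Rightarrow> (real \<Rightarrow> 'a) \<Rightarrow> bool" where
  "damped_solution \<gamma> F u \<longleftrightarrow>
     (\<exists>V W. \<forall>t\<ge>0. (u has_vector_derivative V t) (at t within {0..}) \<and>
                  (V has_vector_derivative W t) (at t within {0..}) \<and>
                  W t + \<gamma> *\<^sub>R V t + F (u t) = 0)"

definition convergent_trajectory :: "(real \<Rightarrow> 'a::{real_inner,complete_space}) \<Rightarrow> bool" where
  "convergent_trajectory u \<longleftrightarrow> (\<exists>L. (u \<longlongrightarrow> L) at_top)"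

definition has_nonconvergent_solution ::
    "real \<Rightarrow> ('a::{real_inner,complete_space} \<Rightarrow> 'a) \<Rightarrow> bool" where
  "has_nonconvergent_solution \<gamma> F \<longleftrightarrow>
     (\<exists>u. damped_solution \<gamma> F u \<and> \<not> convergent_trajectory u)"

text \<open>Standing assumptions on \<open>\<gamma>\<close>, \<open>\<phi>\<close> and \<open>A\<close> in \<open>u'' + \<gamma> u' + \<nabla>\<phi>(u) + A(u) = 0\<close>.\<close>

definition standing_assumptions ::
    "real \<Rightarrow> real \<Rightarrow> ('a::{real_inner,complete_space} \<Rightarrow> real) \<Rightarrow> ('a \<Rightarrow> 'a) \<Rightarrow> bool" where
  "standing_assumptions \<gamma> l \<phi> A \<longleftrightarrow>
     \<gamma> > 0 \<and> l > 0 \<and>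
     convex_on UNIV \<phi> \<and> (\<forall>x. \<phi> differentiable (at x)) \<and>
     lipschitz_on_bounded_sets (gradient \<phi>) \<and>
     maximal_monotone (\<lambda>x. {A x}) \<and> cocoercive l A"

section \<open>The planar rotation\<close>

definition rot :: "real^2 \<Rightarrow> real^2" where
  "rot x = vector [vector [0, -1], vector [1, 0]] *v x"

text \<open>The closed form of the Yosida approximation of \<open>rot\<close>. It also makes sense for \<open>l = 0\<close>,
  where it is \<open>rot\<close> itself, whereas \<open>yosida 0\<close> is meaningless.\<close>

definition rot_lam :: "real \<Rightarrow> real^2 \<Rightarrow> real^2" where
  "rot_lam l x =
     ((1 / (1 + l\<^sup>2)) *\<^sub>R (vector [vector [l, -1], vector [1, l]] :: real^2^2)) *v x"

definition a2 :: "real \<Rightarrow> real \<Rightarrow> real" where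
  "a2 \<gamma> l = (1/2) * (- \<gamma> + (1 / sqrt 2) *
     sqrt ((\<gamma>\<^sup>2 - 4 * l / (1 + l\<^sup>2)) +
           sqrt ((\<gamma>\<^sup>2 - 4 * l / (1 + l\<^sup>2))\<^sup>2 + 16 / (1 + l\<^sup>2)\<^sup>2)))"

definition root_condition :: "real \<Rightarrow> real \<Rightarrow> bool" where
  "root_condition \<gamma> l \<longleftrightarrow>
     sqrt (\<gamma>^4 - 8 * \<gamma>\<^sup>2 * l / (1 + l\<^sup>2) + 16 / (1 + l\<^sup>2)) \<ge> \<gamma>\<^sup>2 + 4 * l / (1 + l\<^sup>2)"

end

theory Submission
  imports Defs "HOL-Real_Asymp.Real_Asymp"
begin

text \<open>The vector \<open>(1, i)\<close> is a complex eigenvector of \<open>rot_lam l\<close> with eigenvalue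
  \<open>(l - i) / (1 + l\<^sup>2)\<close>, so a root \<open>a + i b\<close> of the characteristic equation yields the real solution
  \<open>exp (a t) (cos (b t), - sin (b t))\<close>, which keeps oscillating when \<open>a \<ge> 0\<close> and \<open>b > 0\<close>.\<close>

section \<open>Maximal monotonicity of positive linear operators\<close>

text \<open>Minty's trick: if a monotone extension contained a further value v at x, testing it
  against the points x + t w with w = v - A x and letting t tend to 0 from the right would give
  |w|^2 \<le> 0. Linearity makes the bound linear in t, so only a limit of real numbers is
  taken.\<close>

lemma maximal_monotone_linear:
  fixes A :: "'a::{real_inner,complete_space} \<Rightarrow> 'a"
  assumes "linear A" and pos: "\<And>x. A x \<bullet> x \<ge> 0"
  shows "maximal_monotone (\<lambda>x. {A x})"
proof -
  interpret linear A by fact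
  have "N x = {A x}" if N: "monotone_operator N" and sub: "\<forall>x. {A x} \<subseteq> N x" for N x
  proof -
    have "v = A x" if v: "v \<in> N x" for v
    proof -
      define w where "w = v - A x"
      have *: "w \<bullet> w \<le> t * (A w \<bullet> w)" if t: "t > 0" for t :: real
      proof -
        have "A (x + t *\<^sub>R w) \<in> N (x + t *\<^sub>R w)" using sub by blast
        then have "(v - A (x + t *\<^sub>R w)) \<bullet> (x - (x + t *\<^sub>R w)) \<ge> 0"
          using N v unfolding monotone_operator_def by blast
        moreover have "v - A (x + t *\<^sub>R w) = w - t *\<^sub>R A w"
          by (simp add: w_def add scale)
        \<comment> \<open>The displacement is -t w, so monotonicity reads -t |w|^2 + t^2 (A w, w)
          \<ge> 0.\<close>
        ultimately have "t * (w \<bullet> w) \<le> t * (t * (A w \<bullet> w))"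
          by (simp add: inner_diff_left algebra_simps)
        then show ?thesis using t by simp
      qed
      have "((\<lambda>t. t * (A w \<bullet> w)) \<longlongrightarrow> 0 * (A w \<bullet> w)) (at_right 0)"
        by (intro tendsto_intros)
      moreover have "\<forall>\<^sub>F t in at_right 0. w \<bullet> w \<le> t * (A w \<bullet> w)"
        using * by (rule eventually_mono[OF eventually_at_right_less])
      ultimately have "w \<bullet> w \<le> 0 * (A w \<bullet> w)"
        by (rule tendsto_lowerbound) simp
      then have "w \<bullet> w = 0" using inner_ge_zero[of w] by linarith
      then show ?thesis by (simp add: w_def)
    qed
    then show ?thesis using sub by blast
  qed
  moreover have "monotone_operator (\<lambda>x. {A x})"
    using pos by (auto simp: monotone_operator_def simp flip: diff)
  ultimately show ?thesis unfolding maximal_monotone_def by blast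
qed

lemma gradient_const: "gradient (\<lambda>_. c) x = 0"
  unfolding gradient_def
proof (rule the_equality)
  show "GDERIV (\<lambda>_. c) x :> 0" by (rule GDERIV_const)
next
  fix D assume "GDERIV (\<lambda>_. c) x :> D"
  \<comment> \<open>The derivative h \<mapsto> (h, D) must be the zero map; evaluate it at h =
    D.\<close>
  from has_derivative_unique[OF this[unfolded gderiv_def] has_derivative_const]
  have "D \<bullet> D = 0" by metis
  then show "D = 0" by simp
qed

section \<open>The planar rotation and its Yosida approximation\<close>

lemma rot_components: "rot x $ 1 = - x $ 2" "rot x $ 2 = x $ 1"
  by (simp_all add: rot_def matrix_vector_mult_def sum_2)

lemma rot_lam_components:
  "rot_lam l x $ 1 = (l * x $ 1 - x $ 2) / (1 + l\<^sup>2)"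
  "rot_lam l x $ 2 = (x $ 1 + l * x $ 2) / (1 + l\<^sup>2)"
  by (simp_all add: rot_lam_def matrix_vector_mult_def sum_2 add_divide_distrib diff_divide_distrib)

lemma linear_rot: "linear rot"
  unfolding rot_def by (rule matrix_vector_mul_linear)

lemma linear_rot_lam: "linear (rot_lam l)"
  unfolding rot_lam_def by (rule matrix_vector_mul_linear)

lemma maximal_monotone_rot: "maximal_monotone (\<lambda>x. {rot x})"
  by (rule maximal_monotone_linear[OF linear_rot])
    (simp add: inner_vec_def sum_2 rot_components)

text \<open>Identify the plane with the complex numbers: \<open>rot\<close> is multiplication by i
  and \<open>rot_lam l\<close> by i / (1 + l i), so the resolvent is 1 / (1 + l i) = 1 - l i / (1 +
  l i).\<close>

lemma resolvent_rot:
  "resolvent l (\<lambda>x. {rot x}) x = x - l *\<^sub>R rot_lam l x"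
proof -
  have pos: "1 + l\<^sup>2 > 0" by (smt (verit) zero_le_power2)
  \<comment> \<open>An equivalence gives existence and uniqueness at once, as \<open>THE\<close> in
    \<open>resolvent\<close> demands.\<close>
  have "x = y + l *\<^sub>R rot y \<longleftrightarrow> y = x - l *\<^sub>R rot_lam l x" for y
  proof
    assume x: "x = y + l *\<^sub>R rot y"
    show "y = x - l *\<^sub>R rot_lam l x"
      using pos by (subst x)+
        (simp add: vec_eq_iff forall_2 rot_components rot_lam_components,
          simp add: field_simps power2_eq_square)
  next
    assume y: "y = x - l *\<^sub>R rot_lam l x"
    show "x = y + l *\<^sub>R rot y"
      using pos by (subst y)+
        (simp add: vec_eq_iff forall_2 rot_components rot_lam_components,
          simp add: field_simps power2_eq_square)
  qed
  then show ?thesis by (simp add: resolvent_def)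
qed

lemma yosida_rot: "l \<noteq> 0 \<Longrightarrow> yosida l (\<lambda>x. {rot x}) = rot_lam l"
  by (rule ext) (simp add: yosida_def resolvent_rot)

text \<open>The skew part of the matrix contributes nothing to the quadratic form.\<close>

lemma inner_rot_lam: "rot_lam l x \<bullet> x = (x \<bullet> x) * l / (1 + l\<^sup>2)"
  by (simp add: inner_vec_def sum_2 rot_lam_components add_divide_distrib diff_divide_distrib algebra_simps)

lemma inner_rot_lam_rot_lam: "rot_lam l x \<bullet> rot_lam l x = (x \<bullet> x) / (1 + l\<^sup>2)"
proof -
  have pos: "1 + l\<^sup>2 > 0" by (smt (verit) zero_le_power2)
  have "rot_lam l x \<bullet> rot_lam l x
      = ((l * x $ 1 - x $ 2)\<^sup>2 + (x $ 1 + l * x $ 2)\<^sup>2) / (1 + l\<^sup>2)\<^sup>2"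
    by (simp only: inner_vec_def sum_2 rot_lam_components power2_eq_square inner_real_def
        times_divide_times_eq add_divide_distrib[symmetric])
  also have "(l * x $ 1 - x $ 2)\<^sup>2 + (x $ 1 + l * x $ 2)\<^sup>2 = (x \<bullet> x) * (1 + l\<^sup>2)"
    by (simp add: inner_vec_def sum_2 power2_eq_square algebra_simps)
  finally show ?thesis using pos by (simp add: power2_eq_square)
qed

text \<open>By linearity only z = v - w matters, and both sides equal l |z|^2 / (1 + l^2):
  cocoercivity holds with equality.\<close>

lemma cocoercive_rot_lam: "cocoercive l (rot_lam l)"
  by (simp add: cocoercive_def linear_diff[OF linear_rot_lam, symmetric] power2_norm_eq_inner
      inner_rot_lam inner_rot_lam_rot_lam mult.commute)

lemma maximal_monotone_rot_lam: "l \<ge> 0 \<Longrightarrow> maximal_monotone (\<lambda>x. {rot_lam l x})"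
  by (rule maximal_monotone_linear[OF linear_rot_lam]) (simp add: inner_rot_lam)

text \<open>The zero potential places the linear planar system within the general class.\<close>

lemma standing_assumptions_rot_lam:
  assumes "\<gamma> > 0" "l > 0"
  shows "standing_assumptions \<gamma> l (\<lambda>_. 0) (rot_lam l)"
proof -
  have "gradient (\<lambda>_::real^2. 0) = (\<lambda>_. 0)"
    by (rule ext) (rule gradient_const)
  moreover have "lipschitz_on_bounded_sets (\<lambda>_::real^2. 0::real^2)"
    unfolding lipschitz_on_bounded_sets_def using lipschitz_on_constant by blast
  moreover have "convex_on UNIV (\<lambda>_::real^2. 0::real)"
    by (simp add: convex_on_def)
  ultimately show ?thesis
    using assms maximal_monotone_rot_lam[of l] cocoercive_rot_lam[of l]
    by (simp add: standing_assumptions_def)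
qed

section \<open>Oscillating solutions from characteristic roots\<close>

text \<open>The equations \<open>re\<close> and \<open>im\<close> are the real and imaginary parts
  of r^2 + \<gamma> r + (l - i) / (1 + l^2) = 0 for r = a + i b.\<close>

lemma has_nonconvergent_solution_rot_lam:
  assumes re: "a\<^sup>2 - b\<^sup>2 + \<gamma> * a + l / (1 + l\<^sup>2) = 0"
    and im: "2 * a * b + \<gamma> * b = 1 / (1 + l\<^sup>2)"
    and "a \<ge> 0" "b > 0"
  shows "has_nonconvergent_solution \<gamma> (rot_lam l)"
proof -
  define P where "P t = exp (a * t) * cos (b * t)" for t
  define Q where "Q t = exp (a * t) * sin (b * t)" for t
  define c d :: "real^2" where "c = axis 1 1" and "d = axis 2 1"
  \<comment> \<open>With z = x + i y this is the real part of z exp(r t) (1, i). Differentiation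
    multiplies z by r, so position, velocity and acceleration belong to z = 1, r and r^2.\<close>
  define comb where "comb x y t = (x * P t - y * Q t) *\<^sub>R c - (y * P t + x * Q t) *\<^sub>R d" for x y t
  have P: "(P has_field_derivative a * P t - b * Q t) (at t within S)" for t S
    unfolding P_def Q_def by (auto intro!: derivative_eq_intros simp: algebra_simps)
  have Q: "(Q has_field_derivative b * P t + a * Q t) (at t within S)" for t S
    unfolding P_def Q_def by (auto intro!: derivative_eq_intros simp: algebra_simps)
  have comb: "(comb x y has_vector_derivative comb (a * x - b * y) (b * x + a * y) t) (at t within S)"
    for x y t S
  proof -
    have p: "((\<lambda>t. x * P t - y * Q t) has_field_derivative
        (a * x - b * y) * P t - (b * x + a * y) * Q t) (at t within S)"
      by (rule derivative_eq_intros P Q refl)+ (simp add: algebra_simps)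
    have q: "((\<lambda>t. y * P t + x * Q t) has_field_derivative
        (b * x + a * y) * P t + (a * x - b * y) * Q t) (at t within S)"
      by (rule derivative_eq_intros P Q refl)+ (simp add: algebra_simps)
    show ?thesis
      unfolding comb_def
      using has_vector_derivative_diff[OF
          has_vector_derivative_scaleR[OF p has_vector_derivative_const[of c]]
          has_vector_derivative_scaleR[OF q has_vector_derivative_const[of d]]]
      by simp
  qed
  have comp: "comb x y t $ 1 = x * P t - y * Q t" "comb x y t $ 2 = - (y * P t + x * Q t)" for x y t
    by (simp_all add: comb_def c_def d_def axis_def)
  have "damped_solution \<gamma> (rot_lam l) (comb 1 0)"
    unfolding damped_solution_def
  proof (intro exI allI impI conjI)
    fix t :: real
    show "(comb 1 0 has_vector_derivative comb a b t) (at t within {0..})"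
      using comb[of 1 0] by simp
    show "(comb a b has_vector_derivative comb (a * a - b * b) (b * a + a * b) t) (at t within {0..})"
      by (rule comb)
    \<comment> \<open>Replacing both matrix coefficients by polynomials in a, b and \<gamma> leaves
      a polynomial identity.\<close>
    have re': "l / (1 + l\<^sup>2) = - (a\<^sup>2 - b\<^sup>2 + \<gamma> * a)" using re by simp
    have "rot_lam l (comb 1 0 t) $ 1 = l / (1 + l\<^sup>2) * P t + 1 / (1 + l\<^sup>2) * Q t"
      by (simp add: rot_lam_components comp add_divide_distrib)
    moreover have "rot_lam l (comb 1 0 t) $ 2 = 1 / (1 + l\<^sup>2) * P t - l / (1 + l\<^sup>2) * Q t"
      by (simp add: rot_lam_components comp diff_divide_distrib)
    ultimately show "comb (a * a - b * b) (b * a + a * b) t + \<gamma> *\<^sub>R comb a b t + rot_lam l (comb 1 0 t) = 0"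
      unfolding im[symmetric] re'
      by (simp add: vec_eq_iff forall_2 comp) (simp add: algebra_simps power2_eq_square)
  qed
  moreover have "\<not> convergent_trajectory (comb 1 0)"
  proof
    assume "convergent_trajectory (comb 1 0)"
    then obtain L where "(comb 1 0 \<longlongrightarrow> L) at_top"
      unfolding convergent_trajectory_def by blast
    from tendsto_vec_nth[OF this, of 1] have lim: "(P \<longlongrightarrow> L $ 1) at_top"
      by (simp add: comp)
    have sub: "(\<lambda>n::nat. P (f n)) \<longlonglongrightarrow> L $ 1" if "filterlim f at_top sequentially" for f
      using filterlim_compose[OF lim that] .
    \<comment> \<open>At these times the cosine is 1 and the exponential is at least 1 because a
      \<ge> 0; at the odd multiples of pi / b below, the cosine is -1. The limit would be both \<ge>
      1 and \<le> -1.\<close>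
    have "(\<lambda>n::nat. P (2 * pi * n / b)) \<longlonglongrightarrow> L $ 1"
      by (rule sub) (use \<open>b > 0\<close> in real_asymp)
    moreover have "P (2 * pi * n / b) \<ge> 1" for n :: nat
      using assms cos_2npi[of n] by (simp add: P_def mult.commute mult.left_commute)
    ultimately have "L $ 1 \<ge> 1"
      by (intro LIMSEQ_le_const) blast+
    have "(\<lambda>n::nat. P ((2 * real n + 1) * pi / b)) \<longlonglongrightarrow> L $ 1"
      by (rule sub) (use \<open>b > 0\<close> in real_asymp)
    moreover have "P ((2 * real n + 1) * pi / b) \<le> -1" for n :: nat
    proof -
      have "cos ((2 * real n + 1) * pi) = -1"
        using cos_npi[of "2 * n + 1"] by (simp add: add.commute)
      then show ?thesis using assms by (simp add: P_def)
    qed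
    ultimately have "L $ 1 \<le> -1"
      by (intro LIMSEQ_le_const2) blast+
    with \<open>L $ 1 \<ge> 1\<close> show False by simp
  qed
  ultimately show ?thesis unfolding has_nonconvergent_solution_def by blast
qed

text \<open>The discriminant of the characteristic equation is D + 4 i k, with modulus Z and square
  root s + 2 i k / s. Hence r = (s - \<gamma>) / 2 + i k / s is a root, with real part
  \<open>a2 \<gamma> l\<close>.\<close>

lemma has_nonconvergent_solution_if_a2_nonneg:
  assumes "\<gamma> > 0" "a2 \<gamma> l \<ge> 0"
  shows "has_nonconvergent_solution \<gamma> (rot_lam l)"
proof -
  define k where "k = 1 / (1 + l\<^sup>2)"
  define D where "D = \<gamma>\<^sup>2 - 4 * l * k"
  define Z where "Z = sqrt (D\<^sup>2 + 16 * k\<^sup>2)"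
  define s where "s = sqrt ((D + Z) / 2)"
  have k: "k > 0" unfolding k_def by (smt (verit) divide_pos_pos zero_le_power2)
  have Z2: "Z\<^sup>2 = D\<^sup>2 + 16 * k\<^sup>2" by (simp add: Z_def)
  \<comment> \<open>Strictness comes from k > 0 and gives s > 0 whatever the sign of D, so k / s is
    a positive frequency.\<close>
  have "Z > \<bar>D\<bar>"
    unfolding Z_def using k by (intro real_less_rsqrt) simp
  then have s: "s > 0" and s2: "s\<^sup>2 = (D + Z) / 2" by (simp_all add: s_def)
  have a2: "a2 \<gamma> l = (s - \<gamma>) / 2"
    by (simp add: a2_def s_def Z_def D_def k_def real_sqrt_divide power_divide)
  \<comment> \<open>Divided by s^2, this says that the square of s + 2 i k / s has real part
    D.\<close>
  have "s\<^sup>2 * s\<^sup>2 - D * s\<^sup>2 - 4 * k\<^sup>2 = (Z\<^sup>2 - D\<^sup>2) / 4 - 4 * k\<^sup>2"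
    unfolding s2 by (simp add: field_simps power2_eq_square)
  then have quartic: "s\<^sup>2 * s\<^sup>2 - D * s\<^sup>2 - 4 * k\<^sup>2 = 0" by (simp add: Z2)
  show ?thesis
  proof (rule has_nonconvergent_solution_rot_lam)
    show "(a2 \<gamma> l)\<^sup>2 - (k / s)\<^sup>2 + \<gamma> * a2 \<gamma> l + l / (1 + l\<^sup>2) = 0"
    proof -
      have "l / (1 + l\<^sup>2) = l * k" by (simp add: k_def)
      also have "\<dots> = (\<gamma>\<^sup>2 - D) / 4" by (simp add: D_def)
      finally have "l / (1 + l\<^sup>2) = (\<gamma>\<^sup>2 - D) / 4" .
      moreover have "(k / s)\<^sup>2 = (s\<^sup>2 - D) / 4"
        using quartic s by (simp add: field_simps power2_eq_square)
      ultimately show ?thesis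
        unfolding a2 by (simp only: power2_eq_square) (simp add: algebra_simps add_divide_distrib diff_divide_distrib)
    qed
    show "2 * a2 \<gamma> l * (k / s) + \<gamma> * (k / s) = 1 / (1 + l\<^sup>2)"
      unfolding a2 using s by (simp add: k_def[symmetric] field_simps)
  qed (use k s assms in auto)
qed

section \<open>Algebraic forms of the condition on the root\<close>

text \<open>\<open>sqrt\<close> is monotone on the whole real line, so the radicand may have any
  sign.\<close>

lemma le_sqrt_iff: "0 \<le> y \<Longrightarrow> y \<le> sqrt x \<longleftrightarrow> y\<^sup>2 \<le> x"
  using real_sqrt_le_iff[of "y\<^sup>2" x] by simp

lemma a2_nonneg_iff_root_condition:
  assumes "\<gamma> > 0"
  shows "a2 \<gamma> l \<ge> 0 \<longleftrightarrow> root_condition \<gamma> l"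
proof -
  define k where "k = 1 / (1 + l\<^sup>2)"
  define D where "D = \<gamma>\<^sup>2 - 4 * l * k"
  define Z where "Z = sqrt (D\<^sup>2 + 16 * k\<^sup>2)"
  have "1 + l\<^sup>2 > 0" by (smt (verit) zero_le_power2)
  then have k: "k * (1 + l\<^sup>2) = 1" by (simp add: k_def)
  have "a2 \<gamma> l \<ge> 0 \<longleftrightarrow> sqrt ((D + Z) / 2) \<ge> \<gamma>"
    by (simp add: a2_def Z_def D_def k_def real_sqrt_divide power_divide)
  also have "\<dots> \<longleftrightarrow> (D + Z) / 2 \<ge> \<gamma>\<^sup>2"
    using assms by (intro le_sqrt_iff) simp
  also have "\<dots> \<longleftrightarrow> Z \<ge> \<gamma>\<^sup>2 + 4 * l * k"
    by (auto simp: D_def field_simps)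
  \<comment> \<open>The terms 16 l^2 k^2 and 16 k^2 are grouped so that k (1 + l^2) = 1 reduces them
    to 16 k.\<close>
  also have "D\<^sup>2 + 16 * k\<^sup>2 = \<gamma>^4 - 8 * \<gamma>\<^sup>2 * l * k + 16 * k * (k * (1 + l\<^sup>2))"
    by (simp add: D_def power2_eq_square power4_eq_xxxx algebra_simps)
  then have "Z = sqrt (\<gamma>^4 - 8 * \<gamma>\<^sup>2 * l / (1 + l\<^sup>2) + 16 / (1 + l\<^sup>2))"
    unfolding k by (simp add: Z_def k_def)
  finally show ?thesis by (simp add: root_condition_def k_def)
qed

text \<open>After squaring, \<gamma>^4 cancels and the positive factor 16 k splits off, leaving a
  condition on \<theta> and l^2 k.\<close>

lemma root_condition_theta_iff:
  assumes "\<gamma> > 0" "\<theta> \<ge> 0"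
  shows "root_condition \<gamma> (\<theta> / \<gamma>\<^sup>2) \<longleftrightarrow> \<gamma>^4 * (1 - \<theta>) \<ge> \<theta>^3"
proof -
  define l where "l = \<theta> / \<gamma>\<^sup>2"
  define k where "k = 1 / (1 + l\<^sup>2)"
  have \<theta>: "\<theta> = l * \<gamma>\<^sup>2" and l: "l \<ge> 0" using assms by (simp_all add: l_def)
  have pos: "1 + l\<^sup>2 > 0" by (smt (verit) zero_le_power2)
  then have k0: "k > 0" and k: "k * (1 + l\<^sup>2) = 1" by (simp_all add: k_def)
  have "root_condition \<gamma> l \<longleftrightarrow> \<gamma>\<^sup>2 + 4 * l * k \<le> sqrt (\<gamma>^4 - 8 * \<gamma>\<^sup>2 * l * k + 16 * k)"
    by (simp add: root_condition_def k_def)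
  also have "\<dots> \<longleftrightarrow> (\<gamma>\<^sup>2 + 4 * l * k)\<^sup>2 \<le> \<gamma>^4 - 8 * \<gamma>\<^sup>2 * l * k + 16 * k"
    using l k0 by (intro le_sqrt_iff) simp
  also have "\<dots> \<longleftrightarrow> 0 \<le> 16 * k * (1 - \<theta> - l\<^sup>2 * k)"
    unfolding \<theta> by (simp add: power2_eq_square power4_eq_xxxx algebra_simps)
  also have "\<dots> \<longleftrightarrow> 0 \<le> 1 - \<theta> - l\<^sup>2 * k"
    using k0 by (simp add: zero_le_mult_iff)
  \<comment> \<open>The factor 1 + l^2 clears the denominator in k, and \<gamma>^4 turns l^2 into
    \<theta>^2.\<close>
  also have "\<dots> \<longleftrightarrow> 0 \<le> (\<gamma>^4 * (1 + l\<^sup>2)) * (1 - \<theta> - l\<^sup>2 * k)"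
    using mult_pos_pos[OF zero_less_power[OF assms(1), of 4] pos]
    by (simp only: zero_le_mult_iff) auto
  also have "(\<gamma>^4 * (1 + l\<^sup>2)) * (1 - \<theta> - l\<^sup>2 * k)
      = \<gamma>^4 * (1 + l\<^sup>2) * (1 - \<theta>) - \<gamma>^4 * l\<^sup>2 * (k * (1 + l\<^sup>2))"
    by (simp add: algebra_simps)
  also have "\<dots> = \<gamma>^4 * (1 - \<theta>) - \<theta>^3"
    unfolding k unfolding \<theta> by (simp add: power2_eq_square power3_eq_cube power4_eq_xxxx algebra_simps)
  finally show ?thesis by (simp add: l_def)
qed

section \<open>Counterexamples parametrised by \<theta>\<close>

text \<open>Stated with \<open>rot_lam\<close> so as to include \<theta> = 0, where the operator is
  \<open>rot\<close> itself.\<close>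

lemma has_nonconvergent_solution_theta:
  assumes "\<gamma> > 0" "\<theta> \<ge> 0" "\<gamma>^4 * (1 - \<theta>) \<ge> \<theta>^3"
  shows "has_nonconvergent_solution \<gamma> (rot_lam (\<theta> / \<gamma>\<^sup>2))"
  using assms by (simp add: has_nonconvergent_solution_if_a2_nonneg
      a2_nonneg_iff_root_condition root_condition_theta_iff)

text \<open>For fixed \<theta> the left side is unbounded in \<gamma>. How large \<gamma> must be
  depends on \<theta>: for \<theta> > 0 the inequality fails when \<gamma> is close to 0.\<close>

lemma eventually_theta_inequality:
  assumes "\<theta> < 1"
  shows "\<forall>\<^sub>F \<gamma> in at_top. \<gamma>^4 * (1 - \<theta>) \<ge> (\<theta>::real)^3"
proof -
  have "filterlim (\<lambda>\<gamma>::real. \<gamma>^4 * (1 - \<theta>)) at_top at_top"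
    using assms by real_asymp
  then show ?thesis by (simp add: filterlim_at_top)
qed

text \<open>Take \<gamma> large and l = \<theta> / \<gamma>^2, which is positive since \<theta> > 0.
  The conjunct \<open>l \<noteq> 0\<close> is what later allows \<open>rot_lam l\<close> to be read
  as the Yosida approximation.\<close>

lemma ex_counterexample_theta:
  assumes "\<theta> \<in> {0<..<1::real}"
  shows "\<exists>\<gamma> l. l * \<gamma>\<^sup>2 = \<theta> \<and> l \<noteq> 0 \<and>
    standing_assumptions \<gamma> l (\<lambda>x. 0) (rot_lam l) \<and>
    has_nonconvergent_solution \<gamma> (\<lambda>x. gradient (\<lambda>x. 0) x + rot_lam l x)"
proof -
  have "\<forall>\<^sub>F \<gamma> in at_top. \<gamma> > 0 \<and> \<gamma>^4 * (1 - \<theta>) \<ge> \<theta>^3"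
    using assms by (intro eventually_conj eventually_gt_at_top eventually_theta_inequality) auto
  then obtain \<gamma> where \<gamma>: "\<gamma> > 0" "\<gamma>^4 * (1 - \<theta>) \<ge> \<theta>^3"
    by (rule eventually_happens'[rotated, THEN exE]) auto
  have "\<theta> / \<gamma>\<^sup>2 > 0" using \<gamma> assms by simp
  with \<gamma> assms show ?thesis
    by (intro exI[of _ \<gamma>] exI[of _ "\<theta> / \<gamma>\<^sup>2"])
      (auto simp: gradient_const standing_assumptions_rot_lam has_nonconvergent_solution_theta)
qed

theorem mainTheorem3:
  shows "maximal_monotone (\<lambda>x. {rot x}) \<and>
    (\<forall>\<gamma> l :: real. \<gamma> > 0 \<and> l > 0 \<longrightarrow>
       yosida l (\<lambda>x. {rot x}) = rot_lam l \<and>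
       linear (yosida l (\<lambda>x. {rot x})) \<and>
       cocoercive l (yosida l (\<lambda>x. {rot x})) \<and>
       (a2 \<gamma> l \<ge> 0 \<longrightarrow> has_nonconvergent_solution \<gamma> (yosida l (\<lambda>x. {rot x}))) \<and>
       (a2 \<gamma> l \<ge> 0 \<longleftrightarrow> root_condition \<gamma> l)) \<and>
    (\<forall>\<gamma> \<theta> :: real. \<gamma> > 0 \<and> \<theta> \<ge> 0 \<longrightarrow>
       (root_condition \<gamma> (\<theta> / \<gamma>\<^sup>2) \<longleftrightarrow> \<gamma>^4 * (1 - \<theta>) \<ge> \<theta>^3)) \<and>
    (\<forall>\<theta> \<in> {0..<1::real}.
       (\<forall>\<gamma>>0. \<gamma>^4 * (1 - \<theta>) \<ge> \<theta>^3 \<longrightarrow>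
          has_nonconvergent_solution \<gamma> (rot_lam (\<theta> / \<gamma>\<^sup>2))) \<and>
       (\<forall>\<^sub>F \<gamma> in at_top. has_nonconvergent_solution \<gamma> (rot_lam (\<theta> / \<gamma>\<^sup>2)))) \<and>
    (\<forall>\<theta> \<in> {0<..<1::real}. \<exists>\<gamma> l. l * \<gamma>\<^sup>2 = \<theta> \<and>
       standing_assumptions \<gamma> l (\<lambda>x. 0) (yosida l (\<lambda>x. {rot x})) \<and>
       has_nonconvergent_solution \<gamma>
         (\<lambda>x. gradient (\<lambda>x. 0) x + yosida l (\<lambda>x. {rot x}) x)) \<and>
    \<not> (\<forall>\<gamma> l (\<phi> :: real^2 \<Rightarrow> real) A.
          standing_assumptions \<gamma> l \<phi> A \<and> l * \<gamma>\<^sup>2 < 1 \<longrightarrow>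
          (\<forall>u. damped_solution \<gamma> (\<lambda>x. gradient \<phi> x + A x) u \<longrightarrow> convergent_trajectory u))"
proof (intro conjI allI impI ballI)
  show "maximal_monotone (\<lambda>x. {rot x})" by (rule maximal_monotone_rot)
next
  fix \<gamma> l :: real
  assume gl: "\<gamma> > 0 \<and> l > 0"
  then show Y: "yosida l (\<lambda>x. {rot x}) = rot_lam l" by (simp add: yosida_rot)
  show "linear (yosida l (\<lambda>x. {rot x}))" "cocoercive l (yosida l (\<lambda>x. {rot x}))"
    unfolding Y by (rule linear_rot_lam cocoercive_rot_lam)+
  show "has_nonconvergent_solution \<gamma> (yosida l (\<lambda>x. {rot x}))" if "a2 \<gamma> l \<ge> 0"
    unfolding Y using gl that by (simp add: has_nonconvergent_solution_if_a2_nonneg)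
  show "a2 \<gamma> l \<ge> 0 \<longleftrightarrow> root_condition \<gamma> l"
    using gl by (simp add: a2_nonneg_iff_root_condition)
next
  fix \<gamma> \<theta> :: real
  assume "\<gamma> > 0 \<and> \<theta> \<ge> 0"
  then show "root_condition \<gamma> (\<theta> / \<gamma>\<^sup>2) \<longleftrightarrow> \<gamma>^4 * (1 - \<theta>) \<ge> \<theta>^3"
    by (simp add: root_condition_theta_iff)
next
  fix \<theta> \<gamma> :: real
  assume "\<theta> \<in> {0..<1}" "\<gamma> > 0" "\<gamma>^4 * (1 - \<theta>) \<ge> \<theta>^3"
  then show "has_nonconvergent_solution \<gamma> (rot_lam (\<theta> / \<gamma>\<^sup>2))"
    by (simp add: has_nonconvergent_solution_theta)
next
  fix \<theta> :: real
  assume "\<theta> \<in> {0..<1}"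
  then show "\<forall>\<^sub>F \<gamma> in at_top. has_nonconvergent_solution \<gamma> (rot_lam (\<theta> / \<gamma>\<^sup>2))"
    using eventually_conj[OF eventually_gt_at_top[of 0] eventually_theta_inequality[of \<theta>]]
    by (auto elim!: eventually_mono simp: has_nonconvergent_solution_theta)
next
  fix \<theta> :: real
  assume "\<theta> \<in> {0<..<1}"
  from ex_counterexample_theta[OF this] show "\<exists>\<gamma> l. l * \<gamma>\<^sup>2 = \<theta> \<and>
      standing_assumptions \<gamma> l (\<lambda>x. 0) (yosida l (\<lambda>x. {rot x})) \<and>
      has_nonconvergent_solution \<gamma> (\<lambda>x. gradient (\<lambda>x. 0) x + yosida l (\<lambda>x. {rot x}) x)"
    by (elim ex_forward) (auto simp: yosida_rot)
next
  \<comment> \<open>Any value of \<theta> strictly between 0 and 1 refutes the claim; 1/2 is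
    chosen.\<close>
  obtain \<gamma> l :: real where "l * \<gamma>\<^sup>2 = 1 / 2"
      "standing_assumptions \<gamma> l (\<lambda>x. 0) (rot_lam l)"
      "has_nonconvergent_solution \<gamma> (\<lambda>x. gradient (\<lambda>x. 0) x + rot_lam l x)"
    using ex_counterexample_theta[of "1 / 2"] by auto
  moreover from this(1) have "l * \<gamma>\<^sup>2 < 1" by simp
  ultimately show "\<not> (\<forall>\<gamma> l (\<phi> :: real^2 \<Rightarrow> real) A.
          standing_assumptions \<gamma> l \<phi> A \<and> l * \<gamma>\<^sup>2 < 1 \<longrightarrow>
          (\<forall>u. damped_solution \<gamma> (\<lambda>x. gradient \<phi> x + A x) u \<longrightarrow> convergent_trajectory u))"
    unfolding has_nonconvergent_solution_def by blast
qed

end
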